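(* There exists a Banach space with an unconditional basis that is not strong partially greedy with constant $1$ but is $\lambda$-partially greedy with constant $1$ for some $\lambda>1$.
   Context: Let $(X,\|\cdot\|)$ be an infinite-dimensional Banach space over $\mathbb{K}=\mathbb{R}$ or $\mathbb{C}$ with dual $(X^*,\|\cdot\|_* )$. A basis of $X$ is a sequence $\mathcal{B}=(e_n)_{n=1}^\infty$ in $X$ such that: (1) there is a unique sequence $(e_n^* )_{n=1}^\infty$ in $X^*$ with $e_i^*(e_j)=\delta_{i,j}$ for all $i,j$; (2) $\sup_n\|e_n\|\|e_n^*\|_*<\infty$ and $0<\inf_n\|e_n\|\leqslant\sup_n\|e_n\|<\infty$; (3) $X$ is the norm-closed linear span of $\{e_n\}$; (4) $X^*$ is the weak$^*$-closed linear span of $\{e_n^*\}$. Notation: $\mathbb{N}_0=\mathbb{N}\cup\{0\}$. For $A\subset\mathbb{N}$, $P_A(x)=\sum_{n\in A}e_n^*(x)e_n$ (for infinite $A$, the series is required to converge). $S_n(x)=\sum_{i=1}^n e_i^*(x)e_i$. A finite set $\Lambda\subset\mathbb{N}$ is a greedy set of $x\in X$ if $\min_{n\in\Lambda}|e_n^*(x)|\geqslant\max_{n\notin\Lambda}|e_n^*(x)|$ (the empty set is a greedy set of every $x$). For $m\in\mathbb{N}_0$, $\gamma_m(x)=\sup\{\|x-P_\Lambda(x)\|:\Lambda\text{ is a greedy set of }x,\ |\Lambda|=m\}$ and $\widehat{\sigma}_m(x)=\inf\{\|x-S_n(x)\|:0\leqslant n\leqslant m\}$. $\mathcal{B}$ is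 unconditional if there is $C\geqslant 1$ with $\|P_A(x)\|\leqslant C\|x\|$ for all $x\in X$ and $A\subset\mathbb{N}$. $\mathcal{B}$ is strong partially greedy with constant $C$ if $\gamma_m(x)\leqslant C\widehat{\sigma}_m(x)$ for all $x\in X$, $m\in\mathbb{N}_0$. $\mathcal{B}$ is $\lambda$-partially greedy with constant $C$ if $\gamma_{\lceil\lambda m\rceil}(x)\leqslant C\widehat{\sigma}_m(x)$ for all $x\in X$, $m\in\mathbb{N}_0$. *)

theory Defs
  imports "HOL-Analysis.Analysis" "HOL-Library.Function_Algebras"
begin

text \<open>
  A Banach space is a subset \<open>X\<close> of an ambient vector space together with a norm \<open>N\<close> on \<open>X\<close>
  that need not extend to the ambient space; nothing is required of \<open>N\<close> off \<open>X\<close>.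
  Taking \<open>nat \<Rightarrow> 'k\<close> with pointwise operations as the ambient space loses nothing for spaces with
  a basis: by totality of the coordinate functionals, a vector is determined by its coefficients.
  Sequences are indexed from 0, so \<open>e n\<close> is the basis vector usually written with index \<open>n + 1\<close>.
\<close>

definition pscale :: "'k::field \<Rightarrow> ('i \<Rightarrow> 'k) \<Rightarrow> 'i \<Rightarrow> 'k" where
  "pscale c f = (\<lambda>i. c * f i)"

interpretation pointwise: vector_space pscale
  by unfold_locales (auto simp: pscale_def fun_eq_iff algebra_simps)

locale normed_space_on = vector_space scale
  for scale :: "'k::real_normed_field \<Rightarrow> 'a::ab_group_add \<Rightarrow> 'a" +
  fixes X :: "'a set" and N :: "'a \<Rightarrow> real"
  assumes subspace_X: "subspace X"
    and N_nonneg: "x \<in> X \<Longrightarrow> 0 \<le> N x"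
    and N_eq_0: "x \<in> X \<Longrightarrow> N x = 0 \<longleftrightarrow> x = 0"
    and N_scale: "x \<in> X \<Longrightarrow> N (scale c x) = norm c * N x"
    and N_triangle: "x \<in> X \<Longrightarrow> y \<in> X \<Longrightarrow> N (x + y) \<le> N x + N y"
begin

text \<open>The guard is there because \<^locale>\<open>Metric_space\<close> wants symmetry and nonnegativity
  on the whole type.\<close>

definition ndist :: "'a \<Rightarrow> 'a \<Rightarrow> real" where
  "ndist x y = (if x \<in> X \<and> y \<in> X then N (x - y) else 0)"

sublocale Metric_space X ndist
proof
  fix x y z
  show "0 \<le> ndist x y"
    by (simp add: ndist_def N_nonneg subspace_X subspace_diff)
  show "ndist x y = ndist y x"
  proof (cases "x \<in> X \<and> y \<in> X")
    case True
    then have "N (scale (-1) (x - y)) = N (x - y)"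
      by (subst N_scale) (auto simp: subspace_X subspace_diff)
    with True show ?thesis by (simp add: ndist_def)
  qed (auto simp: ndist_def)
  assume x: "x \<in> X" and y: "y \<in> X"
  then show "ndist x y = 0 \<longleftrightarrow> x = y"
    by (simp add: ndist_def N_eq_0 subspace_X subspace_diff)
  assume z: "z \<in> X"
  show "ndist x z \<le> ndist x y + ndist y z"
    using N_triangle[of "x - y" "y - z"] x y z
    by (simp add: ndist_def subspace_X subspace_diff)
qed

text \<open>A functional on \<open>X\<close> is represented by the function that is 0 off \<open>X\<close>, so that distinct
  functions are distinct functionals and the dual is a subspace of the function space.\<close>

definition dual :: "('a \<Rightarrow> 'k) set" where
  "dual = {f. (\<forall>x\<in>X. \<forall>y\<in>X. f (x + y) = f x + f y) \<and>
              (\<forall>c. \<forall>x\<in>X. f (scale c x) = c * f x) \<and>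
              (\<exists>K. \<forall>x\<in>X. norm (f x) \<le> K * N x) \<and>
              (\<forall>x. x \<notin> X \<longrightarrow> f x = 0)}"

definition dual_norm :: "('a \<Rightarrow> 'k) \<Rightarrow> real" where
  "dual_norm f = (SUP x\<in>{x \<in> X. N x \<le> 1}. norm (f x))"

text \<open>The topology of pointwise convergence; coordinates off \<open>X\<close> are constantly 0.\<close>

definition weak_star :: "('a \<Rightarrow> 'k) topology" where
  "weak_star = subtopology (product_topology (\<lambda>_. euclidean) UNIV) dual"

definition biorthogonal :: "(nat \<Rightarrow> 'a) \<Rightarrow> (nat \<Rightarrow> 'a \<Rightarrow> 'k) \<Rightarrow> bool" where
  "biorthogonal e es \<longleftrightarrow>
     (\<forall>n. es n \<in> dual) \<and> (\<forall>i j. es i (e j) = (if i = j then 1 else 0))"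

end

locale inf_dim_banach_on = normed_space_on +
  assumes complete: "mcomplete"
    and infinite_dim: "\<nexists>B. finite B \<and> X \<subseteq> span B"

locale banach_basis = inf_dim_banach_on scale X N
  for scale :: "'k::real_normed_field \<Rightarrow> 'a::ab_group_add \<Rightarrow> 'a" and X N +
  fixes e :: "nat \<Rightarrow> 'a" and es :: "nat \<Rightarrow> 'a \<Rightarrow> 'k"
  assumes e_in: "e n \<in> X"
    and biorth: "biorthogonal e es"
    and biorth_unique: "biorthogonal e es' \<Longrightarrow> es' = es"
    and bounded_products: "bdd_above (range (\<lambda>n. N (e n) * dual_norm (es n)))"
    and inf_pos: "0 < (INF n. N (e n))"
    and bounded_basis: "bdd_above (range (\<lambda>n. N (e n)))"
    and norm_dense: "mtopology closure_of (span (range e)) = X"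
    and weak_star_dense: "weak_star closure_of (pointwise.span (range es)) = dual"
begin

definition proj_converges :: "nat set \<Rightarrow> 'a \<Rightarrow> 'a \<Rightarrow> bool" where
  "proj_converges A x y \<longleftrightarrow>
     limitin mtopology (\<lambda>k. \<Sum>n\<in>A \<inter> {..<k}. scale (es n x) (e n)) y sequentially"

definition P :: "nat set \<Rightarrow> 'a \<Rightarrow> 'a" where
  "P A x = (if finite A then \<Sum>n\<in>A. scale (es n x) (e n) else THE y. proj_converges A x y)"

definition S :: "nat \<Rightarrow> 'a \<Rightarrow> 'a" where
  "S n x = (\<Sum>i<n. scale (es i x) (e i))"

definition greedy_set :: "'a \<Rightarrow> nat set \<Rightarrow> bool" where
  "greedy_set x L \<longleftrightarrow>
     finite L \<and> (\<forall>n\<in>L. \<forall>k. k \<notin> L \<longrightarrow> norm (es n x) \<ge> norm (es k x))"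

text \<open>Coefficients of \<open>x\<close> tend to 0, so greedy sets of every size exist, and \<open>P L x\<close> takes only
  finitely many values over greedy sets \<open>L\<close> of a given size: the supremum is a maximum.\<close>

definition gamma :: "nat \<Rightarrow> 'a \<Rightarrow> real" where
  "gamma m x = Sup {N (x - P L x) | L. greedy_set x L \<and> card L = m}"

definition sigma_hat :: "nat \<Rightarrow> 'a \<Rightarrow> real" where
  "sigma_hat m x = Inf {N (x - S n x) | n. 0 \<le> n \<and> n \<le> m}"

definition unconditional :: bool where
  "unconditional \<longleftrightarrow>
     (\<exists>C\<ge>1. \<forall>x\<in>X. \<forall>A. (infinite A \<longrightarrow> (\<exists>y. proj_converges A x y)) \<and> N (P A x) \<le> C * N x)"

definition strong_partially_greedy :: "real \<Rightarrow> bool" where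
  "strong_partially_greedy C \<longleftrightarrow> (\<forall>x\<in>X. \<forall>m. gamma m x \<le> C * sigma_hat m x)"

definition lambda_partially_greedy :: "real \<Rightarrow> real \<Rightarrow> bool" where
  "lambda_partially_greedy l C \<longleftrightarrow>
     (\<forall>x\<in>X. \<forall>m. gamma (nat \<lceil>l * real m\<rceil>) x \<le> C * sigma_hat m x)"

end

end

theory Submission imports Defs begin

text \<open>
  The example is \<open>\<ell>\<^sub>1\<close> with the norm \<open>2 * \<bar>x\<^sub>0\<bar> + \<bar>x\<^sub>1\<bar> + \<bar>x\<^sub>2\<bar> + \<dots>\<close> and the unit vectors as basis.
  It is 1-unconditional because a weighted \<open>\<ell>\<^sub>1\<close> norm is monotone in the moduli of the entries.

  For \<open>e\<^sub>0 + e\<^sub>1\<close>, the set containing only the index 1 is greedy. It leaves \<open>e\<^sub>0\<close>, of norm 2, whereas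
  the first partial sum leaves \<open>e\<^sub>1\<close>, of norm 1. So the constant 1 fails at \<open>m = 1\<close>
  (\<open>not_strong_partially_greedy_if_first_heavier\<close>).

  With \<open>\<lambda> = 2\<close> it holds. Let \<open>L\<close> be a greedy set of size \<open>2 * m\<close> and \<open>n \<le> m\<close>. In an \<open>\<ell>\<^sub>1\<close>
  norm, the parts that the two remainders share contribute equally, so what has to be compared is the
  part of \<open>x\<close> on \<open>{..<n} - L\<close>, left only by the greedy algorithm, with the part on
  \<open>L - {..<n}\<close>, left only by the partial sum. Every entry in the second part dominates every
  entry in the first, so it is enough that the second set has at least the total weight of the first
  (\<open>greedy_remainder_le\<close>). It has \<open>2 * m - n\<close> more elements, and for \<open>0 < n \<le> m\<close> this surplus
  is at least 1, which is all the extra weight there is (\<open>first_doubled_weights\<close>). If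
  \<open>n = 0\<close>, the first set is empty.

  The unit vectors form an unconditional basis for all weights between 1 and a constant, and over every
  complete normed field, so the real and the complex space come from one construction.
\<close>

section \<open>Coefficient sequences\<close>

definition l1 :: "(nat \<Rightarrow> 'k::real_normed_vector) set" where
  "l1 = {x. summable (\<lambda>n. norm (x n))}"

definition weighted_norm :: "(nat \<Rightarrow> real) \<Rightarrow> (nat \<Rightarrow> 'k::real_normed_vector) \<Rightarrow> real" where
  "weighted_norm w x = (\<Sum>n. w n * norm (x n))"

definition unit_vec :: "nat \<Rightarrow> nat \<Rightarrow> 'k::zero_neq_one" where
  "unit_vec n = (\<lambda>i. if i = n then 1 else 0)"

text \<open>The value off \<open>l1\<close> is the default that the representation of functionals prescribes.\<close>

definition coord :: "nat \<Rightarrow> (nat \<Rightarrow> 'k) \<Rightarrow> 'k::real_normed_vector" where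
  "coord n x = (if x \<in> l1 then x n else 0)"

definition restr :: "nat set \<Rightarrow> (nat \<Rightarrow> 'k) \<Rightarrow> nat \<Rightarrow> 'k::zero" where
  "restr A x = (\<lambda>n. if n \<in> A then x n else 0)"

lemma limitin_sequentially_in_closure_of:
  assumes "limitin T f l sequentially" "\<And>k. f k \<in> S"
  shows "l \<in> T closure_of S"
  unfolding in_closure_of using assms
  by (fastforce simp: limitin_def eventually_sequentially)

lemma sum_fun_apply: "(\<Sum>n\<in>F. f n) i = (\<Sum>n\<in>F. f n i)"
  for f :: "'b \<Rightarrow> 'c \<Rightarrow> 'd::comm_monoid_add"
  by (induction F rule: infinite_finite_induct) auto

lemma l1_subspace: "pointwise.subspace (l1 :: (nat \<Rightarrow> 'k::real_normed_field) set)"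
proof (rule pointwise.subspaceI)
  show "(0 :: nat \<Rightarrow> 'k) \<in> l1"
    by (simp add: l1_def)
next
  fix x y :: "nat \<Rightarrow> 'k" assume "x \<in> l1" "y \<in> l1"
  then have "summable (\<lambda>n. norm (x n) + norm (y n))"
    by (simp add: l1_def summable_add)
  then show "x + y \<in> l1"
    unfolding l1_def mem_Collect_eq
    by (rule summable_comparison_test') (auto simp: norm_triangle_ineq)
next
  fix c and x :: "nat \<Rightarrow> 'k" assume "x \<in> l1"
  then show "pscale c x \<in> l1"
    by (simp add: l1_def pscale_def norm_mult summable_mult)
qed

lemma restr_in_l1: "x \<in> l1 \<Longrightarrow> restr A x \<in> l1"
  unfolding l1_def mem_Collect_eq
  by (rule summable_comparison_test'[of "\<lambda>n. norm (x n)"]) (auto simp: restr_def)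

lemma unit_vec_in_l1: "(unit_vec n :: nat \<Rightarrow> 'k::real_normed_field) \<in> l1"
  unfolding l1_def mem_Collect_eq
  by (rule summable_finite[of "{n}"]) (auto simp: unit_vec_def)

lemma sum_unit_vec:
  assumes "finite F"
  shows "(\<Sum>n\<in>F. pscale (x n) (unit_vec n)) = restr F x"
  using assms by (auto simp: fun_eq_iff sum_fun_apply pscale_def unit_vec_def restr_def
      if_distrib[of "\<lambda>t. _ * t"] cong: if_cong)

lemma independent_unit_vec:
  "\<not> pointwise.dependent (range (unit_vec :: nat \<Rightarrow> nat \<Rightarrow> 'k::field))"
proof
  assume "pointwise.dependent (range (unit_vec :: nat \<Rightarrow> nat \<Rightarrow> 'k))"
  then obtain n where n: "unit_vec n \<in>
      pointwise.span (range (unit_vec :: nat \<Rightarrow> nat \<Rightarrow> 'k) - {unit_vec n})"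
    unfolding pointwise.dependent_def by auto
  have "pointwise.span (range (unit_vec :: nat \<Rightarrow> nat \<Rightarrow> 'k) - {unit_vec n}) \<subseteq> {x. x n = 0}"
  proof (rule pointwise.span_minimal)
    show "pointwise.subspace {x :: nat \<Rightarrow> 'k. x n = 0}"
      by (rule pointwise.subspaceI) (auto simp: pscale_def)
  qed (auto simp: unit_vec_def)
  with n show False
    by (auto simp: unit_vec_def)
qed

lemma inj_unit_vec: "inj (unit_vec :: nat \<Rightarrow> nat \<Rightarrow> 'k::zero_neq_one)"
  by (rule injI) (metis unit_vec_def zero_neq_one)

lemma l1_infinite_dim:
  "\<nexists>B. finite B \<and> (l1 :: (nat \<Rightarrow> 'k::real_normed_field) set) \<subseteq> pointwise.span B"
proof
  assume "\<exists>B. finite B \<and> (l1 :: (nat \<Rightarrow> 'k) set) \<subseteq> pointwise.span B"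
  then obtain B where B: "finite B" "(l1 :: (nat \<Rightarrow> 'k) set) \<subseteq> pointwise.span B"
    by blast
  moreover have "range unit_vec \<subseteq> (l1 :: (nat \<Rightarrow> 'k) set)"
    by (auto simp: unit_vec_in_l1)
  ultimately have "finite (range (unit_vec :: nat \<Rightarrow> nat \<Rightarrow> 'k))"
    using pointwise.independent_span_bound[OF B(1) independent_unit_vec] by blast
  then show False
    using finite_imageD[OF _ inj_unit_vec] by auto
qed

text \<open>Since the coefficients tend to 0, those outside a given finite set attain their maximum;
  adjoining a maximizer enlarges a greedy set by one index.\<close>

lemma greedy_sets_exist:
  fixes x :: "nat \<Rightarrow> 'k::real_normed_vector"
  assumes "x \<in> l1"
  shows "\<exists>L. finite L \<and> card L = m \<and> (\<forall>n\<in>L. \<forall>k. k \<notin> L \<longrightarrow> norm (x k) \<le> norm (x n))"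
proof (induction m)
  case 0
  show ?case by (rule exI[of _ "{}"]) simp
next
  case (Suc m)
  then obtain L where L: "finite L" "card L = m"
    and greedy: "\<And>n k. n \<in> L \<Longrightarrow> k \<notin> L \<Longrightarrow> norm (x k) \<le> norm (x n)"
    by blast
  have "\<exists>n. n \<notin> L \<and> (\<forall>k. k \<notin> L \<longrightarrow> norm (x k) \<le> norm (x n))"
  proof (cases "\<forall>k. k \<notin> L \<longrightarrow> x k = 0")
    case True
    obtain n where "n \<notin> L"
      using L(1) ex_new_if_finite infinite_UNIV_nat by blast
    with True show ?thesis by auto
  next
    case False
    then obtain j where j: "j \<notin> L" "x j \<noteq> 0" by blast
    have "(\<lambda>n. norm (x n)) \<longlonglongrightarrow> 0"
      using assms summable_LIMSEQ_zero by (auto simp: l1_def)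
    then have "eventually (\<lambda>n. norm (x n) < norm (x j)) sequentially"
      using j by (auto intro: order_tendstoD)
    then obtain M where M: "\<And>n. n \<ge> M \<Longrightarrow> norm (x n) < norm (x j)"
      unfolding eventually_sequentially by blast
    let ?F = "{..<M} - L"
    have "j \<in> ?F" using j M[of j] by (auto simp: not_le[symmetric])
    then have "Max ((\<lambda>n. norm (x n)) ` ?F) \<in> (\<lambda>n. norm (x n)) ` ?F"
      by (intro Max_in) auto
    then obtain n where n: "n \<in> ?F" "norm (x n) = Max ((\<lambda>n. norm (x n)) ` ?F)"
      by force
    have le: "norm (x k) \<le> norm (x n)" if "k \<in> ?F" for k
      unfolding n(2) using that by (intro Max_ge) auto
    have "norm (x k) \<le> norm (x n)" if "k \<notin> L" for k
    proof (cases "k < M")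
      case False
      then show ?thesis using M[of k] le[OF \<open>j \<in> ?F\<close>] by simp
    qed (use le that in auto)
    with n show ?thesis by blast
  qed
  then obtain n where n: "n \<notin> L" "\<And>k. k \<notin> L \<Longrightarrow> norm (x k) \<le> norm (x n)"
    by blast
  show ?case
    by (rule exI[of _ "insert n L"]) (use L n greedy in auto)
qed

section \<open>The weighted norm\<close>

text \<open>The bounds make the weighted norm equivalent to the usual norm of \<open>\<ell>\<^sub>1\<close> and make the unit
  vectors seminormalized.\<close>

locale l1_weight =
  fixes w :: "nat \<Rightarrow> real" and B :: real
  assumes w_ge_1: "1 \<le> w n" and w_le: "w n \<le> B"
begin

lemma w_nonneg: "0 \<le> w n"
  using w_ge_1[of n] by linarith

lemma summable_weighted: "x \<in> l1 \<Longrightarrow> summable (\<lambda>n. w n * norm (x n))"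
  unfolding l1_def mem_Collect_eq
  by (rule summable_comparison_test'[OF summable_mult[of _ B]])
     (auto simp: abs_mult w_nonneg intro!: mult_right_mono w_le)

lemma weighted_norm_nonneg: "x \<in> l1 \<Longrightarrow> 0 \<le> weighted_norm w x"
  unfolding weighted_norm_def by (intro suminf_nonneg summable_weighted) (auto simp: w_nonneg)

lemma norm_le_weighted: "norm (x n) \<le> w n * norm (x n)"
  using mult_right_mono[OF w_ge_1, of "norm (x n)" n] by simp

lemma coord_le_weighted_norm: "x \<in> l1 \<Longrightarrow> norm (x n) \<le> weighted_norm w x"
  using sum_le_suminf[OF summable_weighted, of x "{n}"] norm_le_weighted[of x n]
  by (simp add: weighted_norm_def w_nonneg)

lemma weighted_norm_mono:
  assumes "x \<in> l1" "y \<in> l1" "\<And>n. norm (x n) \<le> norm (y n)"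
  shows "weighted_norm w x \<le> weighted_norm w y"
  unfolding weighted_norm_def using assms
  by (intro suminf_le summable_weighted mult_left_mono w_nonneg)

lemma normed_space_l1:
  "normed_space_on pscale (l1 :: (nat \<Rightarrow> 'k::real_normed_field) set) (weighted_norm w)"
proof unfold_locales
  show "pointwise.subspace (l1 :: (nat \<Rightarrow> 'k) set)"
    by (rule l1_subspace)
next
  fix x :: "nat \<Rightarrow> 'k" assume x: "x \<in> l1"
  show "0 \<le> weighted_norm w x"
    using x by (rule weighted_norm_nonneg)
  show "weighted_norm w x = 0 \<longleftrightarrow> x = 0"
  proof
    assume "weighted_norm w x = 0"
    then show "x = 0"
      using coord_le_weighted_norm[OF x] by (auto simp: fun_eq_iff)
  qed (simp add: weighted_norm_def)
  show "weighted_norm w (pscale c x) = norm c * weighted_norm w x" for c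
    unfolding weighted_norm_def suminf_mult[OF summable_weighted[OF x], symmetric]
    by (simp add: pscale_def norm_mult mult_ac)
next
  fix x y :: "nat \<Rightarrow> 'k" assume xy: "x \<in> l1" "y \<in> l1"
  then have "x + y \<in> l1"
    using l1_subspace pointwise.subspace_add by blast
  note summable_sum = summable_weighted[OF this]
  show "weighted_norm w (x + y) \<le> weighted_norm w x + weighted_norm w y"
    unfolding weighted_norm_def
      suminf_add[OF summable_weighted[OF xy(1)] summable_weighted[OF xy(2)]]
    by (intro suminf_le summable_sum summable_add summable_weighted xy)
       (auto simp: w_nonneg norm_triangle_ineq mult_left_mono simp flip: distrib_left)
qed

sublocale l1: normed_space_on pscale
  "l1 :: (nat \<Rightarrow> 'k::real_normed_field) set" "weighted_norm w"
  by (rule normed_space_l1)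


text \<open>A bound on all finite partial sums of \<open>w n * norm (x n)\<close> both puts \<open>x\<close> into
  \<open>l1\<close> and bounds its norm. Partial sums pass to coordinatewise limits, and this is what makes
  the space complete.\<close>

lemma weighted_norm_le_partial_sums:
  assumes "\<And>M. (\<Sum>n<M. w n * norm (x n)) \<le> K"
  shows "x \<in> l1" "weighted_norm w x \<le> K"
proof -
  have "(\<Sum>n<M. norm (x n)) \<le> K" for M
    using assms[of M] sum_mono[of "{..<M}" "\<lambda>n. norm (x n)" "\<lambda>n. w n * norm (x n)"]
      norm_le_weighted[of x] by fastforce
  then show "x \<in> l1"
    unfolding l1_def mem_Collect_eq
    by (intro bounded_imp_summable[of _ K]) (auto simp only: lessThan_Suc_atMost[symmetric] norm_ge_zero)
  then show "weighted_norm w x \<le> K"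
    unfolding weighted_norm_def using assms by (intro suminf_le_const summable_weighted)
qed

lemma l1_mcomplete:
  "Metric_space.mcomplete (l1 :: (nat \<Rightarrow> 'k::{real_normed_field,banach}) set)
     (normed_space_on.ndist l1 (weighted_norm w))"
proof -
  have diff: "x - y \<in> l1" if "x \<in> l1" "y \<in> l1" for x y :: "nat \<Rightarrow> 'k"
    using that l1_subspace pointwise.subspace_diff by blast
  show ?thesis
    unfolding l1.mcomplete_def
  proof (intro allI impI)
    fix \<sigma> :: "nat \<Rightarrow> nat \<Rightarrow> 'k" assume Cauchy: "l1.MCauchy \<sigma>"
    then have in_l1: "\<sigma> k \<in> l1" for k
      by (auto simp: l1.MCauchy_def)
    have cauchy: "\<exists>K. \<forall>k\<ge>K. \<forall>j\<ge>K. weighted_norm w (\<sigma> j - \<sigma> k) < \<epsilon>" if "\<epsilon> > 0" for \<epsilon>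
      using Cauchy that unfolding l1.MCauchy_def l1.ndist_def by (simp add: in_l1) meson
    have "Cauchy (\<lambda>k. \<sigma> k n)" for n
    proof (rule metric_CauchyI)
      fix \<epsilon> :: real assume "\<epsilon> > 0"
      then obtain K where K: "\<And>k j. k \<ge> K \<Longrightarrow> j \<ge> K \<Longrightarrow> weighted_norm w (\<sigma> j - \<sigma> k) < \<epsilon>"
        using cauchy by blast
      have "dist (\<sigma> j n) (\<sigma> k n) < \<epsilon>" if "j \<ge> K" "k \<ge> K" for j k
        using coord_le_weighted_norm[OF diff[OF in_l1[of j] in_l1[of k]], of n] K[OF that(2,1)]
        by (simp add: dist_norm)
      then show "\<exists>K. \<forall>j\<ge>K. \<forall>k\<ge>K. dist (\<sigma> j n) (\<sigma> k n) < \<epsilon>"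
        by blast
    qed
    then have "\<exists>z. (\<lambda>k. \<sigma> k n) \<longlonglongrightarrow> z" for n
      using Cauchy_convergent by (auto simp: convergent_def)
    then obtain y where y: "\<And>n. (\<lambda>k. \<sigma> k n) \<longlonglongrightarrow> y n"
      by metis
    have close: "y - \<sigma> k \<in> l1 \<and> weighted_norm w (y - \<sigma> k) \<le> \<epsilon>"
      if K: "\<forall>k\<ge>K. \<forall>j\<ge>K. weighted_norm w (\<sigma> j - \<sigma> k) < \<epsilon>" and k: "k \<ge> K" for K k \<epsilon>
    proof -
      have "(\<Sum>n<M. w n * norm ((y - \<sigma> k) n)) \<le> \<epsilon>" for M
      proof (rule LIMSEQ_le_const2)
        show "(\<lambda>j. \<Sum>n<M. w n * norm (\<sigma> j n - \<sigma> k n)) \<longlonglongrightarrow> (\<Sum>n<M. w n * norm ((y - \<sigma> k) n))"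
          by (auto intro!: tendsto_intros y)
        have "(\<Sum>n<M. w n * norm (\<sigma> j n - \<sigma> k n)) \<le> weighted_norm w (\<sigma> j - \<sigma> k)" for j
          using sum_le_suminf[OF summable_weighted[OF diff[OF in_l1[of j] in_l1[of k]]], of "{..<M}"]
          by (simp add: weighted_norm_def w_nonneg)
        then show "\<exists>J. \<forall>j\<ge>J. (\<Sum>n<M. w n * norm (\<sigma> j n - \<sigma> k n)) \<le> \<epsilon>"
          using K k by (meson less_imp_le order_trans)
      qed
      then show ?thesis
        using weighted_norm_le_partial_sums by blast
    qed
    have y_l1: "y \<in> l1"
    proof -
      obtain K where "\<forall>k\<ge>K. \<forall>j\<ge>K. weighted_norm w (\<sigma> j - \<sigma> k) < 1"
        using cauchy[of 1] by auto
      then have "y - \<sigma> K \<in> l1"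
        using close by blast
      then have "(y - \<sigma> K) + \<sigma> K \<in> l1"
        using l1_subspace pointwise.subspace_add in_l1 by blast
      then show ?thesis by simp
    qed
    have "limitin l1.mtopology \<sigma> y sequentially"
      unfolding l1.limitin_metric
    proof (intro conjI allI impI y_l1)
      fix \<epsilon> :: real assume "\<epsilon> > 0"
      then obtain K where "\<forall>k\<ge>K. \<forall>j\<ge>K. weighted_norm w (\<sigma> j - \<sigma> k) < \<epsilon> / 2"
        using cauchy[of "\<epsilon> / 2"] by auto
      from close[OF this] have "l1.ndist y (\<sigma> k) < \<epsilon>" if "k \<ge> K" for k
        using that \<open>\<epsilon> > 0\<close> by (force simp: l1.ndist_def y_l1 in_l1)
      then show "\<forall>\<^sub>F k in sequentially. \<sigma> k \<in> l1 \<and> l1.ndist (\<sigma> k) y < \<epsilon>"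
        unfolding eventually_sequentially by (auto simp: in_l1 l1.commute)
    qed
    then show "\<exists>x. limitin l1.mtopology \<sigma> x sequentially" by blast
  qed
qed

section \<open>The unit vector basis\<close>

text \<open>The error is bounded by a tail of the convergent series that defines the norm of \<open>x\<close>. With
  \<open>A = UNIV\<close> this gives norm density of the span and the expansion of functionals; with general
  \<open>A\<close> it gives unconditional convergence.\<close>

lemma restr_tendsto:
  fixes x :: "nat \<Rightarrow> 'k::real_normed_field"
  assumes "x \<in> l1"
  shows "limitin l1.mtopology (\<lambda>k. restr (A \<inter> {..<k}) x) (restr A x) sequentially"
proof -
  let ?tail = "\<lambda>k. weighted_norm w x - (\<Sum>n<k. w n * norm (x n))"
  have "(\<lambda>n. w n * norm (x n)) sums weighted_norm w x"
    unfolding weighted_norm_def using summable_weighted[OF assms] by (rule summable_sums)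
  then have tail: "?tail \<longlonglongrightarrow> 0"
    unfolding sums_def by (auto intro: tendsto_eq_intros)
  have "l1.ndist (restr (A \<inter> {..<k}) x) (restr A x) \<le> ?tail k" for k
  proof -
    have mono: "weighted_norm w (restr (A \<inter> {..<k}) x - restr A x) \<le> weighted_norm w (restr {k..} x)"
      using assms l1_subspace
      by (intro weighted_norm_mono restr_in_l1 pointwise.subspace_diff) (auto simp: restr_def)
    have "weighted_norm w (restr {k..} x) = (\<Sum>n. w (n + k) * norm (x (n + k)))"
      unfolding weighted_norm_def
      by (subst suminf_split_initial_segment[OF summable_weighted[OF restr_in_l1[OF assms]], of _ k])
         (auto simp: restr_def)
    also have "\<dots> = ?tail k"
      unfolding weighted_norm_def
      by (subst suminf_minus_initial_segment[OF summable_weighted[OF assms]]) simp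
    finally show ?thesis
      using mono assms by (simp add: l1.ndist_def restr_in_l1)
  qed
  then have "(\<lambda>k. l1.ndist (restr (A \<inter> {..<k}) x) (restr A x)) \<longlonglongrightarrow> 0"
    by (intro tendsto_sandwich[OF _ _ tendsto_const tail]) auto
  then show ?thesis
    unfolding l1.limitin_metric_dist_null using assms by (simp add: restr_in_l1)
qed

lemma restr_coord:
  fixes x :: "nat \<Rightarrow> 'k::real_normed_field"
  assumes "x \<in> l1" "finite F"
  shows "(\<Sum>n\<in>F. pscale (coord n x) (unit_vec n)) = restr F x"
  using sum_unit_vec[OF assms(2), of x] assms(1) by (simp add: coord_def)

lemma dual_bounded: "f \<in> l1.dual \<Longrightarrow> \<exists>C. \<forall>x\<in>l1. norm (f x) \<le> C * weighted_norm w x"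
  unfolding l1.dual_def by blast

text \<open>A functional is determined by its values on the unit vectors, which gives uniqueness of the
  coordinate functionals; moreover it is the pointwise limit of finite combinations of them, which gives
  weak* density of their span.\<close>

lemma dual_expansion:
  fixes f :: "(nat \<Rightarrow> 'k::real_normed_field) \<Rightarrow> 'k"
  assumes f: "f \<in> l1.dual" and x: "x \<in> l1"
  shows "(\<lambda>k. \<Sum>n<k. x n * f (unit_vec n)) \<longlonglongrightarrow> f x"
proof -
  obtain C where C: "\<And>y. y \<in> l1 \<Longrightarrow> norm (f y) \<le> C * weighted_norm w y"
    using dual_bounded[OF f] by blast
  have add: "f (y + z) = f y + f z" if "y \<in> l1" "z \<in> l1" for y z
    using f that by (auto simp: l1.dual_def)
  have scale: "f (pscale c y) = c * f y" if "y \<in> l1" for c y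
    using f that by (auto simp: l1.dual_def)
  have f0: "f 0 = 0"
    using scale[of 0 0] l1_subspace pointwise.subspace_0 by fastforce
  have in_l1: "(\<Sum>n\<in>F. pscale (x n) (unit_vec n)) \<in> l1" for F
    by (intro pointwise.subspace_sum pointwise.subspace_scale l1_subspace unit_vec_in_l1)
  have sum: "f (\<Sum>n\<in>F. pscale (x n) (unit_vec n)) = (\<Sum>n\<in>F. x n * f (unit_vec n))" for F
  proof (induction F rule: infinite_finite_induct)
    case (insert n F)
    then show ?case
      using add[OF pointwise.subspace_scale[OF l1_subspace unit_vec_in_l1] in_l1, of "x n" n F]
      by (simp only: sum.insert[OF insert.hyps] scale unit_vec_in_l1 insert.IH)
  qed (simp_all only: sum.infinite sum.empty f0 not_False_eq_True)
  have diff: "f (y - x) = f y - f x" if "y \<in> l1" for y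
    using add[OF pointwise.subspace_diff[OF l1_subspace that x] x]
    unfolding diff_add_cancel by (simp only: add_diff_cancel_right')
  have "(\<lambda>k. l1.ndist (restr {..<k} x) x) \<longlonglongrightarrow> 0"
    using restr_tendsto[OF x, of UNIV] by (simp add: l1.limitin_metric_dist_null restr_def)
  then have lim: "(\<lambda>k. C * l1.ndist (restr {..<k} x) x) \<longlonglongrightarrow> 0"
    by (rule tendsto_mult_right_zero)
  have "(\<lambda>k. f (restr {..<k} x) - f x) \<longlonglongrightarrow> 0"
  proof (rule Lim_null_comparison[OF _ lim], rule always_eventually, rule allI)
    fix k
    have "norm (f (restr {..<k} x - x)) \<le> C * weighted_norm w (restr {..<k} x - x)"
      by (intro C pointwise.subspace_diff l1_subspace restr_in_l1 x)
    then show "norm (f (restr {..<k} x) - f x) \<le> C * l1.ndist (restr {..<k} x) x"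
      by (simp add: diff restr_in_l1 x l1.ndist_def)
  qed
  then have "(\<lambda>k. f (restr {..<k} x)) \<longlonglongrightarrow> f x"
    by (simp add: LIM_zero_iff)
  then show ?thesis
    by (simp add: sum sum_unit_vec[symmetric])
qed

lemma coord_in_dual: "(coord n :: (nat \<Rightarrow> 'k::real_normed_field) \<Rightarrow> 'k) \<in> l1.dual"
  unfolding l1.dual_def
proof (intro CollectI conjI ballI allI impI exI[of _ 1])
  fix x y :: "nat \<Rightarrow> 'k" assume "x \<in> l1" "y \<in> l1"
  then show "coord n (x + y) = coord n x + coord n y"
    using pointwise.subspace_add[OF l1_subspace, of x y] by (simp add: coord_def)
next
  fix c and x :: "nat \<Rightarrow> 'k" assume "x \<in> l1"
  then show "coord n (pscale c x) = c * coord n x"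
    using pointwise.subspace_scale[OF l1_subspace, of x c] by (simp add: coord_def pscale_def)
qed (simp_all add: coord_def coord_le_weighted_norm)

lemma weighted_norm_unit_vec:
  "weighted_norm w (unit_vec n :: nat \<Rightarrow> 'k::real_normed_field) = w n"
  unfolding weighted_norm_def
  by (subst suminf_finite[of "{n}"]) (auto simp: unit_vec_def)

lemma biorthogonal_coord:
  "l1.biorthogonal (unit_vec :: nat \<Rightarrow> nat \<Rightarrow> 'k::real_normed_field) coord"
  unfolding l1.biorthogonal_def using unit_vec_in_l1
  by (auto simp: coord_in_dual coord_def unit_vec_def)

lemma dual_subspace: "pointwise.subspace (l1.dual :: ((nat \<Rightarrow> 'k::real_normed_field) \<Rightarrow> 'k) set)"
proof (rule pointwise.subspaceI)
  show "(0 :: (nat \<Rightarrow> 'k) \<Rightarrow> 'k) \<in> l1.dual"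
    by (auto simp: l1.dual_def intro!: exI[of _ 0])
next
  fix f g :: "(nat \<Rightarrow> 'k) \<Rightarrow> 'k" assume fg: "f \<in> l1.dual" "g \<in> l1.dual"
  obtain C D where C: "\<And>x. x \<in> l1 \<Longrightarrow> norm (f x) \<le> C * weighted_norm w x"
    and D: "\<And>x. x \<in> l1 \<Longrightarrow> norm (g x) \<le> D * weighted_norm w x"
    using dual_bounded[OF fg(1)] dual_bounded[OF fg(2)] by blast
  have "norm ((f + g) x) \<le> (C + D) * weighted_norm w x" if "x \<in> l1" for x
    using C[OF that] D[OF that] norm_triangle_ineq[of "f x" "g x"] by (simp add: distrib_right)
  then have "\<exists>E. \<forall>x\<in>l1. norm ((f + g) x) \<le> E * weighted_norm w x"
    by blast
  with fg show "f + g \<in> l1.dual"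
    unfolding l1.dual_def by (simp add: distrib_left)
next
  fix c and f :: "(nat \<Rightarrow> 'k) \<Rightarrow> 'k" assume f: "f \<in> l1.dual"
  then obtain C where C: "\<And>x. x \<in> l1 \<Longrightarrow> norm (f x) \<le> C * weighted_norm w x"
    using dual_bounded by blast
  have "norm (pscale c f x) \<le> (norm c * C) * weighted_norm w x" if "x \<in> l1" for x
    using mult_left_mono[OF C[OF that], of "norm c"] by (simp add: pscale_def norm_mult mult_ac)
  then have "\<exists>E. \<forall>x\<in>l1. norm (pscale c f x) \<le> E * weighted_norm w x"
    by blast
  with f show "pscale c f \<in> l1.dual"
    unfolding l1.dual_def by (simp add: distrib_left pscale_def)
qed

lemma weak_star_dense_coord:
  "l1.weak_star closure_of
     pointwise.span (range (coord :: nat \<Rightarrow> (nat \<Rightarrow> 'k::real_normed_field) \<Rightarrow> 'k)) = l1.dual"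
proof
  have top: "topspace l1.weak_star = (l1.dual :: ((nat \<Rightarrow> 'k) \<Rightarrow> 'k) set)"
    by (simp add: l1.weak_star_def)
  show "l1.weak_star closure_of
     pointwise.span (range (coord :: nat \<Rightarrow> (nat \<Rightarrow> 'k) \<Rightarrow> 'k)) \<subseteq> l1.dual"
    using closure_of_subset_topspace top by metis
  show "l1.dual \<subseteq> l1.weak_star closure_of
     pointwise.span (range (coord :: nat \<Rightarrow> (nat \<Rightarrow> 'k) \<Rightarrow> 'k))"
  proof
    fix f :: "(nat \<Rightarrow> 'k) \<Rightarrow> 'k" assume f: "f \<in> l1.dual"
    define g :: "nat \<Rightarrow> (nat \<Rightarrow> 'k) \<Rightarrow> 'k"
      where "g k = (\<Sum>n<k. pscale (f (unit_vec n)) (coord n))" for k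
    have g_span: "g k \<in> pointwise.span (range coord)" for k
      unfolding g_def
      by (intro pointwise.span_sum pointwise.span_scale pointwise.span_base) auto
    have g_dual: "g k \<in> l1.dual" for k
      unfolding g_def
      by (intro pointwise.subspace_sum pointwise.subspace_scale dual_subspace coord_in_dual)
    have "(\<lambda>k. g k x) \<longlonglongrightarrow> f x" for x
    proof (cases "x \<in> l1")
      case True
      then show ?thesis
        using dual_expansion[OF f True]
        by (simp add: g_def sum_fun_apply pscale_def coord_def mult.commute)
    next
      case False
      then show ?thesis
        using f by (simp add: g_def sum_fun_apply pscale_def coord_def l1.dual_def)
    qed
    then have "limitin l1.weak_star g f sequentially"
      unfolding l1.weak_star_def limitin_subtopology limitin_componentwise
      using f g_dual by (simp add: always_eventually)
    then show "f \<in> l1.weak_star closure_of pointwise.span (range coord)"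
      using g_span by (rule limitin_sequentially_in_closure_of)
  qed
qed

lemma norm_dense_unit_vec:
  "l1.mtopology closure_of
     pointwise.span (range (unit_vec :: nat \<Rightarrow> nat \<Rightarrow> 'k::real_normed_field)) = l1"
proof
  show "l1.mtopology closure_of
     pointwise.span (range (unit_vec :: nat \<Rightarrow> nat \<Rightarrow> 'k)) \<subseteq> l1"
    using closure_of_subset_topspace l1.topspace_mtopology by metis
  show "l1 \<subseteq> l1.mtopology closure_of
     pointwise.span (range (unit_vec :: nat \<Rightarrow> nat \<Rightarrow> 'k))"
  proof
    fix x :: "nat \<Rightarrow> 'k" assume x: "x \<in> l1"
    have in_span: "restr {..<k} x \<in> pointwise.span (range unit_vec)" for k
      unfolding sum_unit_vec[OF finite_lessThan, symmetric]
      by (intro pointwise.span_sum pointwise.span_scale pointwise.span_base) auto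
    then show "x \<in> l1.mtopology closure_of pointwise.span (range unit_vec)"
      using restr_tendsto[OF x, of UNIV] in_span
      by (intro limitin_sequentially_in_closure_of[where f = "\<lambda>k. restr {..<k} x"])
         (auto simp: restr_def)
  qed
qed

lemma dual_norm_coord_le_1:
  "l1.dual_norm (coord n :: (nat \<Rightarrow> 'k::real_normed_field) \<Rightarrow> 'k) \<le> 1"
  unfolding l1.dual_norm_def
proof (rule cSUP_least)
  have "(0 :: nat \<Rightarrow> 'k) \<in> l1" "weighted_norm w (0 :: nat \<Rightarrow> 'k) \<le> 1"
    by (auto simp: l1_def weighted_norm_def)
  then show "{x :: nat \<Rightarrow> 'k. x \<in> l1 \<and> weighted_norm w x \<le> 1} \<noteq> {}"
    by blast
next
  fix x :: "nat \<Rightarrow> 'k" assume "x \<in> {x. x \<in> l1 \<and> weighted_norm w x \<le> 1}"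
  then show "norm (coord n x) \<le> 1"
    using coord_le_weighted_norm[of x n] by (simp add: coord_def)
qed

sublocale l1: banach_basis pscale
  "l1 :: (nat \<Rightarrow> 'k::{real_normed_field,banach}) set" "weighted_norm w" unit_vec coord
proof unfold_locales
  show "l1.mcomplete TYPE('k)"
    by (rule l1_mcomplete)
  show "\<nexists>B. finite B \<and> (l1 :: (nat \<Rightarrow> 'k) set) \<subseteq> pointwise.span B"
    by (rule l1_infinite_dim)
  show "(unit_vec n :: nat \<Rightarrow> 'k) \<in> l1" for n
    by (rule unit_vec_in_l1)
  show "l1.biorthogonal (unit_vec :: nat \<Rightarrow> nat \<Rightarrow> 'k) coord"
    by (rule biorthogonal_coord)
  show "es' = coord"
    if "l1.biorthogonal (unit_vec :: nat \<Rightarrow> nat \<Rightarrow> 'k) es'" for es'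
  proof (intro ext)
    fix n and x :: "nat \<Rightarrow> 'k"
    have es': "es' n \<in> l1.dual" "\<And>j. es' n (unit_vec j) = (if n = j then 1 else 0)"
      using that by (auto simp: l1.biorthogonal_def)
    show "es' n x = coord n x"
    proof (cases "x \<in> l1")
      case True
      have "coord n (unit_vec j :: nat \<Rightarrow> 'k) = es' n (unit_vec j)" for j
        by (simp add: es' coord_def unit_vec_in_l1) (simp add: unit_vec_def)
      then have "(\<lambda>k. \<Sum>j<k. x j * es' n (unit_vec j)) \<longlonglongrightarrow> coord n x"
        using dual_expansion[OF coord_in_dual True, of n] by simp
      then show ?thesis
        using dual_expansion[OF es'(1) True] LIMSEQ_unique by blast
    next
      case False
      then show ?thesis
        using es'(1) by (simp add: l1.dual_def coord_def)
    qed
  qed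
  show "bdd_above (range (\<lambda>n. weighted_norm w (unit_vec n :: nat \<Rightarrow> 'k) * l1.dual_norm (coord n :: (nat \<Rightarrow> 'k) \<Rightarrow> 'k)))"
  proof (rule bdd_aboveI2)
    fix n
    have "w n * l1.dual_norm (coord n :: (nat \<Rightarrow> 'k) \<Rightarrow> 'k) \<le> w n * 1"
      by (intro mult_left_mono dual_norm_coord_le_1 w_nonneg)
    then show "weighted_norm w (unit_vec n :: nat \<Rightarrow> 'k) * l1.dual_norm (coord n :: (nat \<Rightarrow> 'k) \<Rightarrow> 'k) \<le> B"
      using w_le[of n] by (simp add: weighted_norm_unit_vec)
  qed
  have "1 \<le> (INF n. weighted_norm w (unit_vec n :: nat \<Rightarrow> 'k))"
    by (intro cINF_greatest) (auto simp: weighted_norm_unit_vec w_ge_1)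
  then show "0 < (INF n. weighted_norm w (unit_vec n :: nat \<Rightarrow> 'k))"
    by linarith
  show "bdd_above (range (\<lambda>n. weighted_norm w (unit_vec n :: nat \<Rightarrow> 'k)))"
    by (rule bdd_aboveI2[of _ _ B]) (simp add: weighted_norm_unit_vec w_le)
  show "l1.mtopology closure_of pointwise.span (range (unit_vec :: nat \<Rightarrow> nat \<Rightarrow> 'k)) = l1"
    by (rule norm_dense_unit_vec)
  show "l1.weak_star closure_of
      pointwise.span (range (coord :: nat \<Rightarrow> (nat \<Rightarrow> 'k) \<Rightarrow> 'k)) = l1.dual"
    by (rule weak_star_dense_coord)
qed

lemma P_eq_restr:
  fixes x :: "nat \<Rightarrow> 'k::{real_normed_field,banach}"
  assumes x: "x \<in> l1"
  shows "l1.P A x = restr A x" and "l1.proj_converges A x (restr A x)"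
proof -
  show conv: "l1.proj_converges A x (restr A x)"
    unfolding l1.proj_converges_def using restr_tendsto[OF x, of A] by (simp add: restr_coord x)
  show "l1.P A x = restr A x"
  proof (cases "finite A")
    case True
    then show ?thesis by (simp add: l1.P_def restr_coord x)
  next
    case False
    then show ?thesis
      unfolding l1.P_def using conv
      by (auto simp: l1.proj_converges_def intro!: the_equality
          dest: l1.limitin_metric_unique[OF _ _ trivial_limit_sequentially])
  qed
qed

lemma l1_unconditional:
  "l1.unconditional TYPE('k::{real_normed_field,banach})"
proof -
  have "(infinite A \<longrightarrow> (\<exists>y. l1.proj_converges A x y)) \<and>
      weighted_norm w (l1.P A x) \<le> 1 * weighted_norm w x"
    if x: "x \<in> l1" for x :: "nat \<Rightarrow> 'k" and A
  proof (intro conjI impI)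
    show "\<exists>y. l1.proj_converges A x y"
      using P_eq_restr(2)[OF x] by blast
    show "weighted_norm w (l1.P A x) \<le> 1 * weighted_norm w x"
      unfolding P_eq_restr(1)[OF x] mult_1
      by (intro weighted_norm_mono restr_in_l1 x) (simp add: restr_def)
  qed
  then show ?thesis
    unfolding l1.unconditional_def by (intro exI[of _ 1]) blast
qed

section \<open>Comparing greedy remainders with partial sum remainders\<close>

text \<open>Removing a greedy set \<open>L\<close> keeps the entries in \<open>{..<n} - L\<close> and discards those in
  \<open>L - {..<n}\<close>, compared with removing the first \<open>n\<close> entries. Each discarded
  entry is at least as large as each kept one, so only the total weights have to be compared.\<close>

lemma greedy_remainder_le:
  fixes x :: "nat \<Rightarrow> 'k::{real_normed_field,banach}"
  assumes x: "x \<in> l1" and L: "finite L"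
    and greedy: "\<And>i k. i \<in> L \<Longrightarrow> k \<notin> L \<Longrightarrow> norm (x k) \<le> norm (x i)"
    and weights: "sum w ({..<n} - L) \<le> sum w (L - {..<n})"
  shows "weighted_norm w (restr (- L) x) \<le> weighted_norm w (restr {n..} x)"
proof (cases "{..<n} \<subseteq> L")
  case True
  then show ?thesis
    by (intro weighted_norm_mono restr_in_l1 x) (force simp: restr_def)
next
  case False
  let ?K = "{..<n} - L" and ?D = "L - {..<n}"
  \<comment> \<open>The threshold \<open>t\<close> separates the kept entries on \<open>?K\<close> from the discarded ones on \<open>?D\<close>.\<close>
  define t where "t = Max ((\<lambda>i. norm (x i)) ` ?K)"
  have "t \<in> (\<lambda>i. norm (x i)) ` ?K"
    unfolding t_def using False by (intro Max_in) auto
  then have t0: "0 \<le> t" and t_le: "t \<le> norm (x i)" if "i \<in> L" for i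
    using greedy[OF that] by auto
  have t_ge: "norm (x k) \<le> t" if "k \<in> ?K" for k
    unfolding t_def using that by (intro Max_ge) auto
  have "(\<Sum>i\<in>?K. w i * norm (x i)) \<le> (\<Sum>i\<in>?K. w i * t)"
    by (intro sum_mono mult_left_mono t_ge w_nonneg)
  also have "\<dots> \<le> (\<Sum>i\<in>?D. w i * t)"
    using mult_right_mono[OF weights, of t] \<open>t \<in> _\<close> by (auto simp: sum_distrib_right)
  also have "\<dots> \<le> (\<Sum>i\<in>?D. w i * norm (x i))"
    by (intro sum_mono mult_left_mono t_le w_nonneg) auto
  finally have KD: "(\<Sum>i\<in>?K. w i * norm (x i)) \<le> (\<Sum>i\<in>?D. w i * norm (x i))" .
  have split: "weighted_norm w (restr (A \<union> F) x) =
      weighted_norm w (restr A x) + (\<Sum>i\<in>F. w i * norm (x i))"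
    if "finite F" "A \<inter> F = {}" for A F
  proof -
    have "weighted_norm w (restr F x) = (\<Sum>i\<in>F. w i * norm (x i))"
      unfolding weighted_norm_def using that(1)
      by (subst suminf_finite[of F]) (auto simp: restr_def)
    moreover have "weighted_norm w (restr (A \<union> F) x) =
        weighted_norm w (restr A x) + weighted_norm w (restr F x)"
      unfolding weighted_norm_def
        suminf_add[OF summable_weighted[OF restr_in_l1[OF x]] summable_weighted[OF restr_in_l1[OF x]]]
      using that(2) by (intro suminf_cong) (auto simp: restr_def)
    ultimately show ?thesis by simp
  qed
  have "weighted_norm w (restr (- L) x) =
      weighted_norm w (restr (- L \<inter> {n..}) x) + (\<Sum>i\<in>?K. w i * norm (x i))"
    by (subst split[symmetric]) (auto intro!: arg_cong[of _ _ "\<lambda>A. weighted_norm w (restr A x)"])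
  also have "\<dots> \<le> weighted_norm w (restr (- L \<inter> {n..}) x) + (\<Sum>i\<in>?D. w i * norm (x i))"
    using KD by simp
  also have "\<dots> = weighted_norm w (restr {n..} x)"
    using L by (subst split[symmetric])
      (auto intro!: arg_cong[of _ _ "\<lambda>A. weighted_norm w (restr A x)"])
  finally show ?thesis .
qed

lemma remainder_eq_restr:
  fixes x :: "nat \<Rightarrow> 'k::{real_normed_field,banach}"
  assumes "x \<in> l1"
  shows "x - l1.P L x = restr (- L) x" and "x - l1.S n x = restr {n..} x"
  using assms by (auto simp: P_eq_restr l1.S_def restr_coord restr_def)

lemma greedy_set_iff:
  fixes x :: "nat \<Rightarrow> 'k::{real_normed_field,banach}"
  assumes "x \<in> l1"
  shows "l1.greedy_set x L \<longleftrightarrow>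
    finite L \<and> (\<forall>n\<in>L. \<forall>k. k \<notin> L \<longrightarrow> norm (x k) \<le> norm (x n))"
  using assms by (simp add: l1.greedy_set_def coord_def)

text \<open>Greedy sets of every size exist, so the supremum is over a nonempty set and can be estimated
  one greedy set at a time.\<close>

lemma lambda_partially_greedy_if_weights:
  assumes weights: "\<And>L m n. finite L \<Longrightarrow> card L = nat \<lceil>l * real m\<rceil> \<Longrightarrow> n \<le> m \<Longrightarrow>
    sum w ({..<n} - L) \<le> sum w (L - {..<n})"
  shows "l1.lambda_partially_greedy TYPE('k::{real_normed_field,banach}) l 1"
proof -
  have "l1.gamma (nat \<lceil>l * real m\<rceil>) x \<le> 1 * l1.sigma_hat m x"
    if x: "x \<in> l1" for x :: "nat \<Rightarrow> 'k" and m
    unfolding l1.gamma_def l1.sigma_hat_def mult_1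
  proof (rule cSup_least)
    show "{weighted_norm w (x - l1.P L x) |L. l1.greedy_set x L \<and> card L = nat \<lceil>l * real m\<rceil>} \<noteq> {}"
      using greedy_sets_exist[OF x, of "nat \<lceil>l * real m\<rceil>"] greedy_set_iff[OF x] by blast
  next
    fix r assume "r \<in> {weighted_norm w (x - l1.P L x) |L.
      l1.greedy_set x L \<and> card L = nat \<lceil>l * real m\<rceil>}"
    then obtain L where L: "l1.greedy_set x L" "card L = nat \<lceil>l * real m\<rceil>"
      and r: "r = weighted_norm w (restr (- L) x)"
      using remainder_eq_restr[OF x] by auto
    show "r \<le> Inf {weighted_norm w (x - l1.S n x) |n. 0 \<le> n \<and> n \<le> m}"
    proof (rule cInf_greatest)
      fix s assume "s \<in> {weighted_norm w (x - l1.S n x) |n. 0 \<le> n \<and> n \<le> m}"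
      then obtain n where n: "n \<le> m" and s: "s = weighted_norm w (restr {n..} x)"
        using remainder_eq_restr[OF x] by auto
      show "r \<le> s"
        unfolding r s using L n greedy_set_iff[OF x]
        by (intro greedy_remainder_le x weights) auto
    qed auto
  qed
  then show ?thesis
    unfolding l1.lambda_partially_greedy_def by blast
qed

text \<open>The witness is the sum of the first two unit vectors: both coefficients are equal, so a greedy
  algorithm may select the second one and leave the heavier first one behind.\<close>

lemma not_strong_partially_greedy_if_first_heavier:
  assumes "w 1 < w 0"
  shows "\<not> l1.strong_partially_greedy TYPE('k::{real_normed_field,banach}) 1"
proof
  assume strong: "l1.strong_partially_greedy TYPE('k) 1"
  define x :: "nat \<Rightarrow> 'k" where "x = unit_vec 0 + unit_vec 1"
  have x: "x \<in> l1"
    unfolding x_def by (intro pointwise.subspace_add l1_subspace unit_vec_in_l1)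
  have rest: "restr (- {1}) x = unit_vec 0" "restr {1..} x = unit_vec 1"
    by (auto simp: fun_eq_iff restr_def x_def unit_vec_def)
  have "w 0 \<le> l1.gamma 1 x"
    unfolding l1.gamma_def
  proof (rule cSup_upper)
    have "l1.greedy_set x {1}"
      unfolding greedy_set_iff[OF x] by (auto simp: x_def unit_vec_def)
    moreover have "weighted_norm w (x - l1.P {1} x) = w 0"
      by (simp only: remainder_eq_restr[OF x] rest weighted_norm_unit_vec)
    ultimately show "w 0 \<in> {weighted_norm w (x - l1.P L x) |L. l1.greedy_set x L \<and> card L = 1}"
      by (intro CollectI exI[of _ "{1}"]) simp
    show "bdd_above {weighted_norm w (x - l1.P L x) |L. l1.greedy_set x L \<and> card L = 1}"
    proof (rule bdd_aboveI)
      fix r assume "r \<in> {weighted_norm w (x - l1.P L x) |L. l1.greedy_set x L \<and> card L = 1}"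
      then obtain L where "r = weighted_norm w (restr (- L) x)"
        using remainder_eq_restr[OF x] by auto
      also have "\<dots> \<le> weighted_norm w x"
        by (intro weighted_norm_mono restr_in_l1 x) (simp add: restr_def)
      finally show "r \<le> weighted_norm w x" .
    qed
  qed
  also have "\<dots> \<le> l1.sigma_hat 1 x"
    using strong x unfolding l1.strong_partially_greedy_def by simp
  also have "\<dots> \<le> w 1"
    unfolding l1.sigma_hat_def
  proof (rule cInf_lower)
    have "weighted_norm w (x - l1.S 1 x) = w 1"
      by (simp only: remainder_eq_restr[OF x] rest weighted_norm_unit_vec)
    then show "w 1 \<in> {weighted_norm w (x - l1.S n x) |n. 0 \<le> n \<and> n \<le> 1}"
      by (intro CollectI exI[of _ 1]) simp
    show "bdd_below {weighted_norm w (x - l1.S n x) |n. 0 \<le> n \<and> n \<le> 1}"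
      by (rule bdd_belowI[of _ 0])
         (auto simp only: remainder_eq_restr[OF x] intro!: weighted_norm_nonneg restr_in_l1 x)
  qed
  finally show False
    using assms by simp
qed

end

section \<open>Doubling the first weight\<close>

definition first_doubled :: "nat \<Rightarrow> real" where
  "first_doubled n = (if n = 0 then 2 else 1)"

lemma l1_weight_first_doubled: "l1_weight first_doubled 2"
  by unfold_locales (auto simp: first_doubled_def)

text \<open>Only the index 0 has extra weight, so \<open>{..<n} - L\<close> weighs at most one more than its number
  of elements. Both sides lose the same \<open>L \<inter> {..<n}\<close>, so \<open>L - {..<n}\<close> has
  \<open>2 * m - n\<close> more elements, and this is positive if \<open>n > 0\<close>.\<close>

lemma first_doubled_weights:
  assumes L: "finite L" "card L = 2 * m" and n: "n \<le> m"
  shows "sum first_doubled ({..<n} - L) \<le> sum first_doubled (L - {..<n})"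
proof (cases "n = 0")
  case True
  then show ?thesis
    by (simp add: sum_nonneg first_doubled_def)
next
  case False
  have "sum first_doubled ({..<n} - L) \<le> (\<Sum>i\<in>{..<n} - L. 1 + (if i = 0 then 1 else 0))"
    by (intro sum_mono) (simp add: first_doubled_def)
  also have "\<dots> \<le> real (card ({..<n} - L)) + 1"
    by (subst sum.distrib) simp
  also have "card ({..<n} - L) + 1 \<le> card (L - {..<n})"
    using card_Diff_subset_Int[of "{..<n}" L] card_Diff_subset_Int[of L "{..<n}"]
      card_mono[of "{..<n}" "{..<n} \<inter> L"] L n False
    by (simp add: Int_commute)
  then have "real (card ({..<n} - L)) + 1 \<le> real (card (L - {..<n}))"
    by linarith
  also have "\<dots> = (\<Sum>i\<in>L - {..<n}. 1)"
    by simp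
  also have "\<dots> = sum first_doubled (L - {..<n})"
    using False by (intro sum.cong) (auto simp: first_doubled_def)
  finally show ?thesis .
qed

lemma first_doubled_example:
  "\<exists>(X :: (nat \<Rightarrow> 'k::{real_normed_field,banach}) set) N e es.
      banach_basis pscale X N e es \<and>
      banach_basis.unconditional pscale X N e es \<and>
      \<not> banach_basis.strong_partially_greedy pscale X N e es 1 \<and>
      (\<exists>l>1. banach_basis.lambda_partially_greedy pscale X N e es l 1)"
proof -
  interpret l1_weight first_doubled 2
    by (rule l1_weight_first_doubled)
  have "nat \<lceil>2 * real m\<rceil> = 2 * m" for m
    by linarith
  then have "l1.lambda_partially_greedy TYPE('k) 2 1"
    by (intro lambda_partially_greedy_if_weights first_doubled_weights) auto
  moreover have "\<not> l1.strong_partially_greedy TYPE('k) 1"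
    by (rule not_strong_partially_greedy_if_first_heavier) (simp add: first_doubled_def)
  ultimately show ?thesis
    by (intro exI conjI) (auto intro: l1.banach_basis_axioms l1_unconditional)
qed

theorem theorem1p10:
  "(\<exists>(X :: (nat \<Rightarrow> real) set) N e es.
      banach_basis pscale X N e es \<and>
      banach_basis.unconditional pscale X N e es \<and>
      \<not> banach_basis.strong_partially_greedy pscale X N e es 1 \<and>
      (\<exists>l>1. banach_basis.lambda_partially_greedy pscale X N e es l 1)) \<and>
   (\<exists>(X :: (nat \<Rightarrow> complex) set) N e es.
      banach_basis pscale X N e es \<and>
      banach_basis.unconditional pscale X N e es \<and>
      \<not> banach_basis.strong_partially_greedy pscale X N e es 1 \<and>
      (\<exists>l>1. banach_basis.lambda_partially_greedy pscale X N e es l 1))"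
  by (intro conjI first_doubled_example)

end
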